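(* Let $(H;(\cdot,\cdot))$ be an inner product space over $\mathbb{K}$ ($\mathbb{K}=\mathbb{R}$ or $\mathbb{C}$), let $n\ge 1$, and let $x,y_1,\dots,y_n\in H$. Then for all real $p,q$ with $1<p\le 2$ and $\frac1p+\frac1q=1$, $$\sum_{i=1}^{n}|(x,y_i)|^2\le n^{\frac2p-1}\,\|x\|^2\Big(\sum_{i,j=1}^{n}|(y_i,y_j)|^q\Big)^{1/q}.$$
   Context: The inner product is linear in the first argument and conjugate-linear in the second; $\|x\|=(x,x)^{1/2}$. Completeness of $H$ is not assumed. *)

theory Defs
  imports "HOL-Analysis.Analysis"
begin

text \<open>
  Real inner product spaces are the types of class \<open>real_inner\<close>, where
  \<open>norm x = sqrt (inner x x)\<close> and no completeness is assumed.  The locale below is the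
  complex counterpart, linear in the first argument.  By conjugate symmetry \<open>ip x x\<close> is
  real, so that \<open>Re (ip x x)\<close> is its value.
\<close>

locale complex_inner_product_space = vector_space scale
  for scale :: "complex \<Rightarrow> 'a::ab_group_add \<Rightarrow> 'a" +
  fixes ip :: "'a \<Rightarrow> 'a \<Rightarrow> complex"
  assumes ip_add_left: "ip (x + y) z = ip x z + ip y z"
    and ip_scale_left: "ip (scale a x) y = a * ip x y"
    and ip_commute: "ip y x = cnj (ip x y)"
    and ip_self_nonneg: "0 \<le> Re (ip x x)"
    and ip_self_eq_0: "ip x x = 0 \<Longrightarrow> x = 0"

definition ip_norm :: "('a \<Rightarrow> 'a \<Rightarrow> complex) \<Rightarrow> 'a \<Rightarrow> real" where
  "ip_norm ip x = sqrt (Re (ip x x))"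

end

theory Submission
  imports Defs
begin

text \<open>
  Put \<open>S = (\<Sum>i. \<bar>(x, y\<^sub>i)\<bar>\<^sup>2)\<close> and \<open>z = (\<Sum>i. (x, y\<^sub>i) y\<^sub>i)\<close>. Then \<open>S = (x, z)\<close>, so the
  Cauchy-Schwarz inequality bounds \<open>S\<^sup>2\<close> by the product of the squared norms of \<open>x\<close> and \<open>z\<close>.
  Expanding the latter, bounding its terms by their moduli and applying Hoelder's inequality to the
  double sum yields \<open>(\<Sum>i. \<bar>(x, y\<^sub>i)\<bar> powr p) powr (2 / p)\<close> times the \<open>q\<close>-norm of
  the Gram matrix. Comparing \<open>p\<close>-norm and \<open>2\<close>-norm bounds the first factor by
  \<open>n powr (2 / p - 1) * S\<close>, and one factor \<open>S\<close> cancels.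
\<close>

context complex_inner_product_space
begin

lemma ip_zero_left: "ip 0 z = 0"
  using ip_add_left[of 0 0 z] by simp

lemma ip_sum_left: "ip (sum f A) z = (\<Sum>i\<in>A. ip (f i) z)"
  by (induction A rule: infinite_finite_induct) (simp_all add: ip_zero_left ip_add_left)

lemma ip_add_right: "ip z (x + y) = ip z x + ip z y"
  by (metis ip_add_left ip_commute complex_cnj_add)

lemma ip_scale_right: "ip x (scale a y) = cnj a * ip x y"
  by (metis ip_scale_left ip_commute complex_cnj_mult)

lemma ip_sum_right: "ip z (sum f A) = (\<Sum>i\<in>A. ip z (f i))"
  by (metis (no_types, lifting) ip_sum_left ip_commute cnj_sum sum.cong)

text \<open>The squared norm of \<open>x + t z\<close> is a nonnegative quadratic in the real
  parameter \<open>t\<close>. Real \<open>t\<close> sees only the real part of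
  \<open>ip x z\<close>, which is enough because the \<open>z\<close> used later makes
  \<open>ip x z\<close> real.\<close>

lemma Cauchy_Schwarz_Re: "(Re (ip x z))\<^sup>2 \<le> Re (ip x x) * Re (ip z z)"
proof (cases "Re (ip z z) = 0")
  case True
  \<comment> \<open>Definiteness speaks of the complex value \<open>ip z z\<close>, so its imaginary
    part has to vanish as well.\<close>
  moreover have "Im (ip z z) = 0"
    using ip_commute[of z z] by (simp add: complex_eq_iff)
  ultimately have "z = 0"
    by (intro ip_self_eq_0) (simp add: complex_eq_iff)
  then have "ip x z = 0"
    using ip_add_right[of x 0 0] by simp
  with True show ?thesis by simp
next
  case False
  \<comment> \<open>The minimiser of the quadratic, which gives the sharpest bound.\<close>
  define t where "t = - Re (ip x z) / Re (ip z z)"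
  have pos: "Re (ip z z) > 0"
    using False ip_self_nonneg[of z] by linarith
  have "Re (ip z x) = Re (ip x z)"
    using ip_commute[of z x] by simp
  then have "Re (ip (x + scale t z) (x + scale t z))
      = Re (ip x x) + 2 * t * Re (ip x z) + t\<^sup>2 * Re (ip z z)"
    by (simp add: ip_add_left ip_add_right ip_scale_left ip_scale_right power2_eq_square algebra_simps)
  then have "0 \<le> Re (ip x x) + 2 * t * Re (ip x z) + t\<^sup>2 * Re (ip z z)"
    using ip_self_nonneg[of "x + scale t z"] by simp
  also have "\<dots> = Re (ip x x) - (Re (ip x z))\<^sup>2 / Re (ip z z)"
    using pos by (simp add: t_def field_simps power2_eq_square)
  finally show ?thesis
    using pos by (simp add: field_simps)
qed

text \<open>Passing to moduli here leaves only nonnegative reals, so that the rest of the argument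
  is the same for both scalar fields.\<close>

lemma Bessel_Gram_bound:
  "(\<Sum>i\<in>A. (cmod (ip x (y i)))\<^sup>2)\<^sup>2
    \<le> (ip_norm ip x)\<^sup>2
      * (\<Sum>i\<in>A. \<Sum>j\<in>A. cmod (ip x (y i)) * cmod (ip x (y j)) * cmod (ip (y i) (y j)))"
proof -
  define z where "z = (\<Sum>i\<in>A. scale (ip x (y i)) (y i))"
  \<comment> \<open>Conjugate-linearity in the second argument pairs each coefficient with its own
    conjugate, so \<open>ip x z\<close> is real and taking its real part loses nothing.\<close>
  have "ip x z = (\<Sum>i\<in>A. cnj (ip x (y i)) * ip x (y i))"
    by (simp add: z_def ip_sum_right ip_scale_right)
  also have "\<dots> = (\<Sum>i\<in>A. of_real ((cmod (ip x (y i)))\<^sup>2))"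
    by (intro sum.cong refl) (simp only: complex_norm_square mult.commute)
  finally have S: "Re (ip x z) = (\<Sum>i\<in>A. (cmod (ip x (y i)))\<^sup>2)"
    by simp
  have "ip z z = (\<Sum>i\<in>A. \<Sum>j\<in>A. ip x (y i) * (cnj (ip x (y j)) * ip (y i) (y j)))"
    unfolding z_def ip_sum_right ip_sum_left ip_scale_left ip_scale_right sum_distrib_left
    by (subst sum.swap) (simp add: mult.left_commute)
  then have "cmod (ip z z)
      \<le> (\<Sum>i\<in>A. \<Sum>j\<in>A. cmod (ip x (y i)) * cmod (ip x (y j)) * cmod (ip (y i) (y j)))"
    by (auto intro!: sum_norm_le simp: norm_mult mult.assoc)
  with complex_Re_le_cmod[of "ip z z"] have "Re (ip z z)
      \<le> (\<Sum>i\<in>A. \<Sum>j\<in>A. cmod (ip x (y i)) * cmod (ip x (y j)) * cmod (ip (y i) (y j)))"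
    by linarith
  then have "Re (ip x x) * Re (ip z z)
      \<le> Re (ip x x) * (\<Sum>i\<in>A. \<Sum>j\<in>A. cmod (ip x (y i)) * cmod (ip x (y j)) * cmod (ip (y i) (y j)))"
    by (rule mult_left_mono) (rule ip_self_nonneg)
  moreover have "(ip_norm ip x)\<^sup>2 = Re (ip x x)"
    by (simp add: ip_norm_def ip_self_nonneg)
  ultimately show ?thesis
    using Cauchy_Schwarz_Re[of x z] unfolding S by simp
qed

end

text \<open>The same choice of \<open>z\<close> works over the reals, where the conjugations
  disappear.\<close>

lemma real_Bessel_Gram_bound:
  fixes x :: "'a::real_inner"
  shows "(\<Sum>i\<in>A. \<bar>inner x (y i)\<bar>\<^sup>2)\<^sup>2
    \<le> (norm x)\<^sup>2 * (\<Sum>i\<in>A. \<Sum>j\<in>A. \<bar>inner x (y i)\<bar> * \<bar>inner x (y j)\<bar> * \<bar>inner (y i) (y j)\<bar>)"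
proof -
  define z where "z = (\<Sum>i\<in>A. inner x (y i) *\<^sub>R y i)"
  have S: "inner x z = (\<Sum>i\<in>A. \<bar>inner x (y i)\<bar>\<^sup>2)"
    by (simp add: z_def inner_sum_right power2_eq_square)
  have "inner z z = (\<Sum>i\<in>A. \<Sum>j\<in>A. inner x (y i) * inner x (y j) * inner (y i) (y j))"
    by (simp add: z_def inner_sum_left inner_sum_right sum_distrib_left mult_ac inner_commute)
  also have "\<dots> \<le> (\<Sum>i\<in>A. \<Sum>j\<in>A. \<bar>inner x (y i)\<bar> * \<bar>inner x (y j)\<bar> * \<bar>inner (y i) (y j)\<bar>)"
    by (intro sum_mono) (metis abs_ge_self abs_mult)
  finally have "inner x x * inner z z
      \<le> (norm x)\<^sup>2 * (\<Sum>i\<in>A. \<Sum>j\<in>A. \<bar>inner x (y i)\<bar> * \<bar>inner x (y j)\<bar> * \<bar>inner (y i) (y j)\<bar>)"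
    by (simp add: mult_left_mono power2_norm_eq_inner)
  with Cauchy_Schwarz_ineq[of x z] show ?thesis
    unfolding S by linarith
qed

text \<open>After both factors are scaled to unit norm, Young's inequality holds termwise and its
  right-hand sides add up to \<open>1 / p + 1 / q = 1\<close>. A vanishing norm rules out the
  scaling, but then every product is zero.\<close>

lemma Holder_inequality_sum:
  fixes f g :: "'a \<Rightarrow> real"
  assumes fin: "finite A" and pq: "p > 1" "q > 1" "1 / p + 1 / q = 1"
    and f: "\<And>i. i \<in> A \<Longrightarrow> f i \<ge> 0" and g: "\<And>i. i \<in> A \<Longrightarrow> g i \<ge> 0"
  shows "(\<Sum>i\<in>A. f i * g i)
    \<le> (\<Sum>i\<in>A. f i powr p) powr (1 / p) * (\<Sum>i\<in>A. g i powr q) powr (1 / q)"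
proof (cases "(\<Sum>i\<in>A. f i powr p) = 0 \<or> (\<Sum>i\<in>A. g i powr q) = 0")
  case True
  then have "(\<forall>i\<in>A. f i = 0) \<or> (\<forall>i\<in>A. g i = 0)"
    using fin by (auto simp: sum_nonneg_eq_0_iff)
  then have "(\<Sum>i\<in>A. f i * g i) = 0"
    by (intro sum.neutral) auto
  then show ?thesis
    by simp
next
  case False
  define F where "F = (\<Sum>i\<in>A. f i powr p)"
  define G where "G = (\<Sum>i\<in>A. g i powr q)"
  define a where "a = F powr (1 / p)"
  define b where "b = G powr (1 / q)"
  have F: "F > 0" and G: "G > 0"
    using False by (auto simp: F_def G_def less_le sum_nonneg)
  then have a: "a > 0" "a powr p = F" and b: "b > 0" "b powr q = G"
    using pq by (auto simp: a_def b_def powr_powr)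
  have "(\<Sum>i\<in>A. (f i / a) * (g i / b)) \<le> (\<Sum>i\<in>A. (f i / a) powr p / p + (g i / b) powr q / q)"
    using a b f g pq by (intro sum_mono Youngs_inequality) auto
  also have "\<dots> = (\<Sum>i\<in>A. f i powr p / F / p + g i powr q / G / q)"
    using a b f g by (intro sum.cong refl) (simp add: powr_divide)
  also have "\<dots> = F / F / p + G / G / q"
    unfolding F_def G_def by (simp only: sum.distrib sum_divide_distrib)
  also have "\<dots> = 1"
    using F G pq by simp
  finally have "(\<Sum>i\<in>A. f i * g i) / (a * b) \<le> 1"
    by (simp add: sum_divide_distrib)
  then show ?thesis
    using a b unfolding a_def b_def F_def G_def by (simp add: divide_le_eq)
qed

text \<open>This is Hoelder's inequality against the constant 1 with the conjugate exponents
  \<open>2 / p\<close> and \<open>2 / (2 - p)\<close>. The second is infinite in the limit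
  \<open>p = 2\<close>, hence the case split.\<close>

lemma sum_powr_le_sum_squares:
  fixes a :: "'a \<Rightarrow> real"
  assumes "finite A" and "1 < p" "p \<le> 2" and a: "\<And>i. i \<in> A \<Longrightarrow> a i \<ge> 0"
  shows "(\<Sum>i\<in>A. a i powr p) powr (2 / p) \<le> real (card A) powr (2 / p - 1) * (\<Sum>i\<in>A. (a i)\<^sup>2)"
proof (cases "p = 2")
  case True
  have "(\<Sum>i\<in>A. a i powr 2) = (\<Sum>i\<in>A. (a i)\<^sup>2)"
    using a by (intro sum.cong refl) (simp add: powr_numeral)
  \<comment> \<open>The empty set is separate because \<open>0 powr 0 = 0\<close>.\<close>
  moreover have "A = {} \<or> real (card A) powr 0 = 1"
    using assms(1) by auto
  ultimately show ?thesis
    using True by (auto simp: sum_nonneg)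
next
  case False
  define S where "S = (\<Sum>i\<in>A. (a i)\<^sup>2)"
  have S: "S \<ge> 0"
    by (simp add: S_def sum_nonneg)
  have p: "1 < p" "p < 2"
    using assms False by auto
  have "(\<Sum>i\<in>A. a i powr p * 1)
      \<le> (\<Sum>i\<in>A. (a i powr p) powr (2 / p)) powr (1 / (2 / p))
        * (\<Sum>i\<in>A. 1 powr (2 / (2 - p))) powr (1 / (2 / (2 - p)))"
    using p assms(1) by (intro Holder_inequality_sum) (auto simp: field_simps)
  also have "(\<Sum>i\<in>A. (a i powr p) powr (2 / p)) = S"
    unfolding S_def using p a by (intro sum.cong refl) (simp add: powr_powr powr_numeral)
  finally have "(\<Sum>i\<in>A. a i powr p) \<le> S powr (p / 2) * real (card A) powr ((2 - p) / 2)"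
    by simp
  then have "(\<Sum>i\<in>A. a i powr p) powr (2 / p)
      \<le> (S powr (p / 2) * real (card A) powr ((2 - p) / 2)) powr (2 / p)"
    using p by (intro powr_mono2) (auto simp: sum_nonneg)
  also have "\<dots> = S * real (card A) powr (2 / p - 1)"
  proof -
    have "(2 - p) / 2 * (2 / p) = 2 / p - 1" and "p / 2 * (2 / p) = 1"
      using p by (simp_all add: field_simps)
    then show ?thesis
      using p S by (simp add: powr_mult powr_powr del: times_divide_eq_left times_divide_eq_right)
  qed
  finally show ?thesis
    by (simp add: S_def mult.commute)
qed

text \<open>Hoelder's inequality is applied over index pairs, with \<open>a i * a j\<close> as one
  factor and \<open>g i j\<close> as the other.\<close>

lemma sum_Gram_le_powr:
  fixes a :: "'a \<Rightarrow> real" and g :: "'a \<Rightarrow> 'a \<Rightarrow> real"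
  assumes fin: "finite A" and p: "1 < p" "p \<le> 2" and q: "1 / p + 1 / q = 1"
    and a: "\<And>i. a i \<ge> 0" and g: "\<And>i j. g i j \<ge> 0"
  shows "(\<Sum>i\<in>A. \<Sum>j\<in>A. a i * a j * g i j)
    \<le> real (card A) powr (2 / p - 1) * (\<Sum>i\<in>A. (a i)\<^sup>2)
      * (\<Sum>i\<in>A. \<Sum>j\<in>A. g i j powr q) powr (1 / q)"
proof -
  \<comment> \<open>Conjugacy alone forces \<open>q > 1\<close>, since \<open>1 / q\<close> lies
    strictly between 0 and 1.\<close>
  have "1 / q = 1 - 1 / p" "1 / p < 1" "1 / p > 0"
    using p q by auto
  then have "0 < 1 / q" "1 / q < 1"
    by linarith+
  then have q1: "q > 1"
    by (simp add: divide_less_eq split: if_splits)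
  have "(\<Sum>i\<in>A. \<Sum>j\<in>A. a i * a j * g i j)
      = (\<Sum>k\<in>A \<times> A. (a (fst k) * a (snd k)) * g (fst k) (snd k))"
    by (simp add: sum.cartesian_product case_prod_unfold)
  also have "\<dots> \<le> (\<Sum>k\<in>A \<times> A. (a (fst k) * a (snd k)) powr p) powr (1 / p)
      * (\<Sum>k\<in>A \<times> A. g (fst k) (snd k) powr q) powr (1 / q)"
    using fin p q q1 a g by (intro Holder_inequality_sum) auto
  \<comment> \<open>The \<open>p\<close>-th powers of the products \<open>a i * a j\<close> factor
    into two equal single sums; this square turns the outer exponent \<open>1 / p\<close> into
    \<open>2 / p\<close>.\<close>
  also have "(\<Sum>k\<in>A \<times> A. (a (fst k) * a (snd k)) powr p) = (\<Sum>i\<in>A. a i powr p) powr 2"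
    by (simp add: powr_mult a sum_nonneg powr_numeral power2_eq_square sum_product
        sum.cartesian_product case_prod_unfold)
  also have "((\<Sum>i\<in>A. a i powr p) powr 2) powr (1 / p) = (\<Sum>i\<in>A. a i powr p) powr (2 / p)"
    by (simp add: powr_powr)
  also have "(\<Sum>k\<in>A \<times> A. g (fst k) (snd k) powr q) = (\<Sum>i\<in>A. \<Sum>j\<in>A. g i j powr q)"
    by (simp add: sum.cartesian_product case_prod_unfold)
  finally show ?thesis
    using sum_powr_le_sum_squares[OF fin p, of a] a
    by (meson mult_right_mono order_trans powr_ge_zero)
qed

text \<open>Dividing by \<open>s\<close> fails for \<open>s = 0\<close>, where
  \<open>c \<ge> 0\<close> gives the claim.\<close>

lemma cancel_square_le:
  fixes s c :: real
  assumes "s\<^sup>2 \<le> c * s" and "c \<ge> 0" and "s \<ge> 0"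
  shows "s \<le> c"
  using assms by (cases "s = 0") (simp_all add: power2_eq_square)

text \<open>The part common to both scalar fields: \<open>a i\<close> stands for the modulus of
  \<open>(x, y i)\<close>, \<open>g i j\<close> for that of \<open>(y i, y j)\<close>, and
  \<open>X\<close> for the squared norm of \<open>x\<close>.\<close>

lemma sum_squares_le_of_Gram_bound:
  fixes a :: "'a \<Rightarrow> real" and g :: "'a \<Rightarrow> 'a \<Rightarrow> real"
  assumes "finite A" and "1 < p" "p \<le> 2" and "1 / p + 1 / q = 1"
    and "\<And>i. a i \<ge> 0" and "\<And>i j. g i j \<ge> 0" and "X \<ge> 0"
    and bound: "(\<Sum>i\<in>A. (a i)\<^sup>2)\<^sup>2 \<le> X * (\<Sum>i\<in>A. \<Sum>j\<in>A. a i * a j * g i j)"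
  shows "(\<Sum>i\<in>A. (a i)\<^sup>2)
    \<le> real (card A) powr (2 / p - 1) * X * (\<Sum>i\<in>A. \<Sum>j\<in>A. g i j powr q) powr (1 / q)"
proof (rule cancel_square_le)
  have "X * (\<Sum>i\<in>A. \<Sum>j\<in>A. a i * a j * g i j)
    \<le> X * (real (card A) powr (2 / p - 1) * (\<Sum>i\<in>A. (a i)\<^sup>2)
      * (\<Sum>i\<in>A. \<Sum>j\<in>A. g i j powr q) powr (1 / q))"
    by (intro mult_left_mono sum_Gram_le_powr assms)
  with bound show "(\<Sum>i\<in>A. (a i)\<^sup>2)\<^sup>2
    \<le> real (card A) powr (2 / p - 1) * X * (\<Sum>i\<in>A. \<Sum>j\<in>A. g i j powr q) powr (1 / q)
      * (\<Sum>i\<in>A. (a i)\<^sup>2)"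
    by (simp add: mult_ac)
qed (use \<open>X \<ge> 0\<close> in \<open>simp_all add: sum_nonneg\<close>)

theorem mainTheorem2:
  fixes n :: nat and p q :: real
  assumes "n \<ge> 1" and "1 < p" and "p \<le> 2" and "1 / p + 1 / q = 1"
  shows
    "(\<forall>(x :: 'a::real_inner) (y :: nat \<Rightarrow> 'a).
        (\<Sum>i=1..n. \<bar>inner x (y i)\<bar> ^ 2)
          \<le> real n powr (2 / p - 1) * norm x ^ 2
             * (\<Sum>i=1..n. \<Sum>j=1..n. \<bar>inner (y i) (y j)\<bar> powr q) powr (1 / q))
     \<and>
     (\<forall>(scale :: complex \<Rightarrow> 'b::ab_group_add \<Rightarrow> 'b) (ip :: 'b \<Rightarrow> 'b \<Rightarrow> complex)
        (x :: 'b) (y :: nat \<Rightarrow> 'b).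
        complex_inner_product_space scale ip \<longrightarrow>
        (\<Sum>i=1..n. cmod (ip x (y i)) ^ 2)
          \<le> real n powr (2 / p - 1) * ip_norm ip x ^ 2
             * (\<Sum>i=1..n. \<Sum>j=1..n. cmod (ip (y i) (y j)) powr q) powr (1 / q))"
proof (intro conjI allI impI)
  fix x :: 'a and y :: "nat \<Rightarrow> 'a"
  show "(\<Sum>i=1..n. \<bar>inner x (y i)\<bar> ^ 2)
      \<le> real n powr (2 / p - 1) * norm x ^ 2
         * (\<Sum>i=1..n. \<Sum>j=1..n. \<bar>inner (y i) (y j)\<bar> powr q) powr (1 / q)"
    using sum_squares_le_of_Gram_bound[OF _ assms(2-4) _ _ _ real_Bessel_Gram_bound, of "{1..n}" x y]
    by simp
next
  fix scale :: "complex \<Rightarrow> 'b \<Rightarrow> 'b" and ip :: "'b \<Rightarrow> 'b \<Rightarrow> complex" and x :: 'b and y :: "nat \<Rightarrow> 'b"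
  assume "complex_inner_product_space scale ip"
  then interpret complex_inner_product_space scale ip .
  show "(\<Sum>i=1..n. cmod (ip x (y i)) ^ 2)
      \<le> real n powr (2 / p - 1) * ip_norm ip x ^ 2
         * (\<Sum>i=1..n. \<Sum>j=1..n. cmod (ip (y i) (y j)) powr q) powr (1 / q)"
    using sum_squares_le_of_Gram_bound[OF _ assms(2-4) _ _ _ Bessel_Gram_bound, of "{1..n}" x y]
    by simp
qed

end
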